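(* Let $n$ be a power of two. Then the graph $\mathcal{B}_n$ contains an independent set of size at least $n!/9^n$.
   Context: $S_n$ is the symmetric group on $[n]=\{1,\ldots,n\}$. A permutation $\tau\in S_n$ is called a cycle if, except for its fixed points, it consists of a single non-trivial cycle (of any length between $2$ and $n$; in particular the identity is not a cycle). Let $\mathcal{C}_n\subset S_n$ be the set of cycles. The (Birkhoff polytope) graph $\mathcal{B}_n=\mathrm{Cay}(S_n,\mathcal{C}_n)$ is the undirected graph with vertex set $S_n$ and edges $\{\pi,\tau\pi\}$ for $\pi\in S_n$, $\tau\in\mathcal{C}_n$. An independent set is a set $A\subset S_n$ containing no two adjacent vertices, i.e. there are no $\pi,\pi'\in A$ with $\pi(\pi')^{-1}\in\mathcal{C}_n$. *)

theory Defs
  imports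
    Complex_Main
    "HOL-Combinatorics.Orbits"
    "HOL-Algebra.Sym_Groups"
    "Graph_Theory.Pair_Digraph"
begin

definition cycles :: "nat \<Rightarrow> (nat \<Rightarrow> nat) set" where
  "cycles n = {\<tau> \<in> carrier (sym_group n). cyclic_on \<tau> {x. \<tau> x \<noteq> x}}"

text \<open>As usual in the Graph Theory library, an undirected edge is a pair of opposite arcs.
  Both arcs are present here when \<open>S\<close> is closed under inverses, as the cycles are
  (\<open>pair_graph_birkhoff_graph\<close> below).\<close>

definition cayley_graph :: "('a, 'b) monoid_scheme \<Rightarrow> 'a set \<Rightarrow> 'a pair_pre_digraph" where
  "cayley_graph G S =
     \<lparr>pverts = carrier G, parcs = {(x, s \<otimes>\<^bsub>G\<^esub> x) | x s. x \<in> carrier G \<and> s \<in> S}\<rparr>"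

definition birkhoff_graph :: "nat \<Rightarrow> (nat \<Rightarrow> nat) pair_pre_digraph" where
  "birkhoff_graph n = cayley_graph (sym_group n) (cycles n)"

definition independent_set :: "'a pair_pre_digraph \<Rightarrow> 'a set \<Rightarrow> bool" where
  "independent_set G A \<longleftrightarrow> A \<subseteq> pverts G \<and> (\<forall>x\<in>A. \<forall>y\<in>A. \<not> x \<rightarrow>\<^bsub>G\<^esub> y)"

lemma cycles_inv: 
  assumes "\<tau> \<in> cycles n" shows "inv' \<tau> \<in> cycles n"
proof -
  have p: "\<tau> permutes {1..n}" and c: "cyclic_on \<tau> {x. \<tau> x \<noteq> x}"
    using assms by (auto simp: cycles_def sym_group_carrier)
  have "permutation \<tau>" using p by (auto simp: permutation_permutes)
  then have "orbit (inv' \<tau>) = orbit \<tau>" by (intro ext orbit_inv_eq)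
  moreover have "{x. inv' \<tau> x \<noteq> x} = {x. \<tau> x \<noteq> x}"
    using p by (metis permutes_inverses)
  ultimately have "cyclic_on (inv' \<tau>) {x. inv' \<tau> x \<noteq> x}"
    using c unfolding cyclic_on_def by metis
  then show ?thesis
    using permutes_inv[OF p] unfolding cycles_def sym_group_carrier by blast
qed

lemma birkhoff_graph_arc_iff:
  "\<pi>' \<rightarrow>\<^bsub>birkhoff_graph n\<^esub> \<pi> \<longleftrightarrow>
     \<pi> permutes {1..n} \<and> \<pi>' permutes {1..n} \<and> \<pi> \<circ> inv' \<pi>' \<in> cycles n"
proof
  assume "\<pi>' \<rightarrow>\<^bsub>birkhoff_graph n\<^esub> \<pi>"
  then obtain \<tau> where "\<pi>' permutes {1..n}" "\<tau> \<in> cycles n" "\<pi> = \<tau> \<circ> \<pi>'"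
    by (auto simp: birkhoff_graph_def cayley_graph_def sym_group_def)
  then show "\<pi> permutes {1..n} \<and> \<pi>' permutes {1..n} \<and> \<pi> \<circ> inv' \<pi>' \<in> cycles n"
    by (auto simp: cycles_def sym_group_carrier permutes_compose comp_assoc permutes_inv_o)
next
  assume *: "\<pi> permutes {1..n} \<and> \<pi>' permutes {1..n} \<and> \<pi> \<circ> inv' \<pi>' \<in> cycles n"
  then have "\<pi> = (\<pi> \<circ> inv' \<pi>') \<circ> \<pi>'"
    using permutes_inv_o(2)[of \<pi>' "{1..n}"] by (metis comp_assoc comp_id)
  with * show "\<pi>' \<rightarrow>\<^bsub>birkhoff_graph n\<^esub> \<pi>"
    by (auto simp: birkhoff_graph_def cayley_graph_def sym_group_def)
qed

lemma pair_graph_birkhoff_graph: "pair_graph (birkhoff_graph n)"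
proof -
  let ?G = "birkhoff_graph n"
  have verts: "pverts ?G = {\<pi>. \<pi> permutes {1..n}}"
    by (auto simp: birkhoff_graph_def cayley_graph_def sym_group_carrier)
  have arcs: "(\<pi>', \<pi>) \<in> parcs ?G \<longleftrightarrow>
      \<pi> permutes {1..n} \<and> \<pi>' permutes {1..n} \<and> \<pi> \<circ> inv' \<pi>' \<in> cycles n" for \<pi> \<pi>'
    using birkhoff_graph_arc_iff by simp
  have wf: "parcs ?G \<subseteq> pverts ?G \<times> pverts ?G"
    by (auto simp: arcs verts)
  have fin: "finite (pverts ?G)"
    unfolding verts by (rule finite_permutations) simp
  have "id \<notin> cycles n"
    by (auto simp: cycles_def cyclic_on_def)
  then have irrefl: "(\<pi>, \<pi>) \<notin> parcs ?G" for \<pi>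
    by (auto simp: arcs permutes_inv_o)
  have sym: "(\<pi>, \<pi>') \<in> parcs ?G" if "(\<pi>', \<pi>) \<in> parcs ?G" for \<pi> \<pi>'
  proof -
    have p: "\<pi> permutes {1..n}" "\<pi>' permutes {1..n}" and "\<pi> \<circ> inv' \<pi>' \<in> cycles n"
      using that by (auto simp: arcs)
    moreover have "inv' (\<pi> \<circ> inv' \<pi>') = \<pi>' \<circ> inv' \<pi>"
      using p by (metis o_inv_distrib permutes_bij permutes_inv permutes_inv_inv)
    ultimately show ?thesis
      using cycles_inv[of "\<pi> \<circ> inv' \<pi>'" n] by (simp add: arcs)
  qed
  show ?thesis
  proof
    show "finite (parcs ?G)"
      using finite_subset[OF wf] fin by simp
    show "Digraph.symmetric (with_proj ?G)"
      unfolding Digraph.symmetric_def by (auto intro!: symI sym)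
  qed (use wf fin irrefl in auto)
qed

end

theory Submission
  imports Defs
begin

text \<open>Think of a permutation as a perfect matching of rows and columns, both indexed by binary
  strings of length \<open>k\<close>. Two adjacent permutations differ along one simple alternating cycle.
  Going down from the highest bit \<open>s\<close>, suppose that the rows of this cycle agree above bit \<open>s\<close>, and
  likewise its columns. Then each row is determined by its lowest \<open>s + 1\<close> bits, and recording for
  every value of these bits the parity of the number of matched edges whose column has bit \<open>s\<close> set
  forces the two edges at each row of the cycle to have columns with the same bit \<open>s\<close>. Hence all
  columns of the cycle agree on bit \<open>s\<close>, so they are determined by their lowest \<open>s\<close> bits, and
  \<open>2\<^sup>s\<close> further parities force the rows to agree on bit \<open>s\<close> as well. In the end the cycle has a
  single row, which is absurd. Therefore permutations with the same \<open>3 (2\<^sup>k - 1)\<close> parities are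
  never adjacent, and the most frequent choice of parities is attained by at least \<open>n! / 8\<^sup>n\<close>
  permutations.\<close>

text \<open>Outside \<open>a\<close> the two filtered sets coincide, so equal parities leave
  \<open>P\<close> and \<open>Q\<close> no room to differ at \<open>a\<close>.\<close>

lemma odd_card_filter_eq_imp:
  assumes "finite S" "a \<in> S"
    and "\<And>x. x \<in> S - {a} \<Longrightarrow> P x \<longleftrightarrow> Q x"
    and "odd (card {x \<in> S. P x}) \<longleftrightarrow> odd (card {x \<in> S. Q x})"
  shows "P a \<longleftrightarrow> Q a"
proof -
  have card: "card {x \<in> S. R x} = card {x \<in> S - {a}. R x} + of_bool (R a)" for R
  proof (cases "R a")
    case True
    with assms have "{x \<in> S. R x} = insert a {x \<in> S - {a}. R x}" by auto
    with True assms(1) show ?thesis by simp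
  next
    case False
    then have "{x \<in> S. R x} = {x \<in> S - {a}. R x}" by auto
    with False show ?thesis by simp
  qed
  have "{x \<in> S - {a}. P x} = {x \<in> S - {a}. Q x}"
    using assms(3) by blast
  with assms(4) card[of P] card[of Q] show ?thesis
    by (simp add: of_bool_def split: if_splits)
qed

lemma cyclic_on_invariant:
  assumes "cyclic_on f S" and "\<And>x. x \<in> S \<Longrightarrow> h (f x) = h x" and "x \<in> S" "y \<in> S"
  shows "h x = h y"
proof -
  obtain a where a: "a \<in> S" and S: "S = orbit f a"
    using assms(1) unfolding cyclic_on_def by blast
  have "h z = h a" if "z \<in> orbit f a" for z
    using that
  proof induction
    case base
    show ?case using a by (rule assms(2))
  next
    case (step z)
    then show ?case using assms(2)[of z] S by simp
  qed
  with assms(3,4) show ?thesis unfolding S by simp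
qed

lemma div_exp_eq_of_div_exp_Suc_eq:
  fixes a b :: nat
  assumes "a div 2 ^ Suc s = b div 2 ^ Suc s" "odd (a div 2 ^ s) \<longleftrightarrow> odd (b div 2 ^ s)"
  shows "a div 2 ^ s = b div 2 ^ s"
proof -
  have "a div 2 ^ s div 2 = b div 2 ^ s div 2"
    using assms(1) by (simp only: power_Suc2 div_mult2_eq)
  moreover have "a div 2 ^ s mod 2 = b div 2 ^ s mod 2"
    using assms(2) by (simp add: mod2_eq_if)
  ultimately show ?thesis
    by (metis div_mult_mod_eq)
qed

lemma nat_eq_of_div_mod_eq:
  fixes a b :: nat
  assumes "a div m = b div m" "a mod m = b mod m"
  shows "a = b"
  using assms by (metis div_mult_mod_eq)

text \<open>Points of \<open>{1..n}\<close> are shifted by one, so that for \<open>n = 2\<^sup>k\<close> they become the binary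
  strings of length \<open>k\<close>.\<close>

definition odd_crossing :: "nat \<Rightarrow> nat \<Rightarrow> nat \<Rightarrow> (nat \<Rightarrow> nat) \<Rightarrow> nat \<Rightarrow> bool" where
  "odd_crossing n u s \<pi> i \<longleftrightarrow>
     odd (card {x \<in> {1..n}. (x - 1) mod 2 ^ u = i \<and> odd ((\<pi> x - 1) div 2 ^ s)})"

text \<open>Row classes keep \<open>s + 1\<close> low bits, since bit \<open>s\<close> of the rows
  is still open when these parities are used. Column classes need only \<open>s\<close> low bits,
  because by then the columns agree on bit \<open>s\<close>.\<close>

definition signature :: "nat \<Rightarrow> (nat \<Rightarrow> nat) \<Rightarrow> (nat \<times> nat) set \<times> (nat \<times> nat) set" where
  "signature k \<pi> =
     ({(s, i). s < k \<and> i < 2 ^ Suc s \<and> odd_crossing (2 ^ k) (Suc s) s \<pi> i},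
      {(s, j). s < k \<and> j < 2 ^ s \<and> odd_crossing (2 ^ k) s s (inv' \<pi>) j})"

text \<open>All points where \<pi> and \<rho> differ share the high bits of \<open>x\<close>, so
  among the points with its low \<open>u\<close> bits only \<open>x\<close> itself can be one of
  them. Equal parities then settle \<open>x\<close>.\<close>

lemma odd_crossing_eq_imp:
  assumes eq: "odd_crossing n u s \<pi> ((x - 1) mod 2 ^ u) \<longleftrightarrow> odd_crossing n u s \<rho> ((x - 1) mod 2 ^ u)"
    and x: "x \<in> {1..n}"
    and block: "\<And>z. z \<in> {1..n} \<Longrightarrow> \<pi> z \<noteq> \<rho> z \<Longrightarrow> (z - 1) div 2 ^ u = (x - 1) div 2 ^ u"
  shows "odd ((\<pi> x - 1) div 2 ^ s) \<longleftrightarrow> odd ((\<rho> x - 1) div 2 ^ s)"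
proof -
  let ?P = "\<lambda>\<pi> z. (z - 1) mod 2 ^ u = (x - 1) mod 2 ^ u \<and> odd ((\<pi> z - 1) div 2 ^ s)"
  have "?P \<pi> x \<longleftrightarrow> ?P \<rho> x"
  proof (rule odd_card_filter_eq_imp[of "{1..n}" x "?P \<pi>" "?P \<rho>"])
    fix z assume z: "z \<in> {1..n} - {x}"
    show "?P \<pi> z \<longleftrightarrow> ?P \<rho> z"
    proof (cases "\<pi> z = \<rho> z \<or> (z - 1) mod 2 ^ u \<noteq> (x - 1) mod 2 ^ u")
      case False
      with block[of z] z have "(z - 1) div 2 ^ u = (x - 1) div 2 ^ u"
        by blast
      with False have "z - 1 = x - 1"
        using nat_eq_of_div_mod_eq by blast
      moreover have "z \<ge> 1" "x \<ge> 1"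
        using x z by simp_all
      ultimately have "z = x"
        by linarith
      with z show ?thesis by simp
    qed auto
  qed (use x eq in \<open>auto simp: odd_crossing_def\<close>)
  then show ?thesis by simp
qed

lemma not_cycle_of_signature_eq:
  assumes \<pi>: "\<pi> permutes {1..2 ^ k}" and \<rho>: "\<rho> permutes {1..2 ^ k}"
    and sig: "signature k \<pi> = signature k \<rho>"
  shows "\<rho> \<circ> inv' \<pi> \<notin> cycles (2 ^ k)"
proof
  define n :: nat where "n = 2 ^ k"
  define \<tau> where "\<tau> = \<rho> \<circ> inv' \<pi>"
  \<comment> \<open>\<tau> moves columns: \<open>C\<close> consists of the columns of the
    alternating cycle, and its rows are \<open>inv' \<pi> y\<close> for \<open>y\<close> in
    \<open>C\<close>.\<close>
  define C where "C = {y. \<tau> y \<noteq> y}"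
  assume "\<rho> \<circ> inv' \<pi> \<in> cycles (2 ^ k)"
  then have cyc: "cyclic_on \<tau> C" and \<tau>: "\<tau> permutes {1..n}"
    by (auto simp: cycles_def \<tau>_def C_def n_def sym_group_carrier)
  have C_sub: "C \<subseteq> {1..n}"
    using \<tau> by (auto simp: C_def permutes_def)
  have inv_sub: "inv' \<pi> y \<in> {1..n}" if "y \<in> C" for y
    using that C_sub \<pi> permutes_in_image[OF permutes_inv[OF \<pi>]] by (auto simp: n_def)
  have \<pi>_inv: "\<pi> (inv' \<pi> y) = y" "inv' \<pi> (\<pi> y) = y" for y
    using \<pi> by (simp_all add: permutes_inverses)
  have \<rho>_inv: "\<rho> (inv' \<rho> y) = y" "inv' \<rho> (\<rho> y) = y" for y
    using \<rho> by (simp_all add: permutes_inverses)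
  have inj: "y = z" if "\<tau> y = \<tau> z" for y z
    using that \<tau> by (metis permutes_inverses(2))
  have \<tau>_C: "\<tau> y \<in> C" if "y \<in> C" for y
    using that by (auto simp: C_def dest: inj)
  have row: "odd_crossing n (Suc s) s \<pi> i \<longleftrightarrow> odd_crossing n (Suc s) s \<rho> i"
    if "s < k" "i < 2 ^ Suc s" for s i
    using sig that unfolding signature_def n_def by (simp add: set_eq_iff) blast
  have col: "odd_crossing n s s (inv' \<pi>) j \<longleftrightarrow> odd_crossing n s s (inv' \<rho>) j"
    if "s < k" "j < 2 ^ s" for s j
    using sig that unfolding signature_def n_def by (simp add: set_eq_iff) blast
  have block: "\<forall>y\<in>C. \<forall>z\<in>C. (y - 1) div 2 ^ s = (z - 1) div 2 ^ s \<and>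
      (inv' \<pi> y - 1) div 2 ^ s = (inv' \<pi> z - 1) div 2 ^ s" if "s \<le> k" for s
    using that
  proof (induction s rule: inc_induct)
    case base
    have "(y - 1) div 2 ^ k = 0" if "y \<in> {1..n}" for y
      using that by (auto simp: n_def)
    with C_sub inv_sub show ?case by (metis subsetD)
  next
    case (step s)
    have cols: "(y - 1) div 2 ^ s = (z - 1) div 2 ^ s" if "y \<in> C" "z \<in> C" for y z
    proof -
      \<comment> \<open>\<open>y\<close> and \<open>\<tau> y\<close> are the columns that \<pi> and
        \<rho> assign to the row \<open>inv' \<pi> y\<close>.\<close>
      have "odd ((\<tau> y - 1) div 2 ^ s) \<longleftrightarrow> odd ((y - 1) div 2 ^ s)" if y: "y \<in> C" for y
      proof -
        have "odd ((\<pi> (inv' \<pi> y) - 1) div 2 ^ s) \<longleftrightarrow> odd ((\<rho> (inv' \<pi> y) - 1) div 2 ^ s)"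
        proof (rule odd_crossing_eq_imp[of n "Suc s" s \<pi> "inv' \<pi> y" \<rho>])
          fix x assume "\<pi> x \<noteq> \<rho> x"
          then have "\<pi> x \<in> C"
            by (auto simp: C_def \<tau>_def \<pi>_inv)
          then show "(x - 1) div 2 ^ Suc s = (inv' \<pi> y - 1) div 2 ^ Suc s"
            using step.IH y \<pi>_inv by metis
        qed (use row step.hyps inv_sub y in auto)
        then show ?thesis by (simp add: \<pi>_inv \<tau>_def)
      qed
      from cyclic_on_invariant[where h = "\<lambda>y. odd ((y - 1) div 2 ^ s)", OF cyc this that]
      show ?thesis
        using step.IH that by (metis div_exp_eq_of_div_exp_Suc_eq)
    qed
    moreover have "(inv' \<pi> y - 1) div 2 ^ s = (inv' \<pi> z - 1) div 2 ^ s" if "y \<in> C" "z \<in> C" for y z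
    proof -
      \<comment> \<open>Both rows belong to the column \<open>\<tau> y\<close>: the first under
        \<pi>, the second under \<rho>.\<close>
      have "odd ((inv' \<pi> (\<tau> y) - 1) div 2 ^ s) \<longleftrightarrow> odd ((inv' \<pi> y - 1) div 2 ^ s)" if y: "y \<in> C" for y
      proof -
        have "odd ((inv' \<pi> (\<tau> y) - 1) div 2 ^ s) \<longleftrightarrow> odd ((inv' \<rho> (\<tau> y) - 1) div 2 ^ s)"
        proof (rule odd_crossing_eq_imp[of n s s "inv' \<pi>" "\<tau> y" "inv' \<rho>"])
          fix x assume "inv' \<pi> x \<noteq> inv' \<rho> x"
          then have "x \<in> C"
            unfolding C_def \<tau>_def by (metis (mono_tags, lifting) \<rho>_inv(2) comp_apply mem_Collect_eq)
          then show "(x - 1) div 2 ^ s = (\<tau> y - 1) div 2 ^ s"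
            using cols y \<tau>_C by blast
        qed (use col step.hyps subsetD[OF C_sub \<tau>_C[OF y]] in auto)
        then show ?thesis by (simp add: \<rho>_inv \<tau>_def)
      qed
      from cyclic_on_invariant[where h = "\<lambda>y. odd ((inv' \<pi> y - 1) div 2 ^ s)", OF cyc this that]
      show ?thesis
        using step.IH that by (metis div_exp_eq_of_div_exp_Suc_eq)
    qed
    ultimately show ?case by blast
  qed
  obtain y where y: "y \<in> C"
    using cyc by (auto simp: cyclic_on_def)
  \<comment> \<open>At \<open>s = 0\<close> all bits agree. Truncated subtraction identifies 0 and
    1, hence the lower bounds that follow.\<close>
  have "y - 1 = \<tau> y - 1"
    using block[rule_format, OF le0 y \<tau>_C[OF y]] by simp
  moreover have "y \<ge> 1" "\<tau> y \<ge> 1"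
    using C_sub y \<tau>_C by force+
  ultimately show False
    using y by (simp add: C_def)
qed

lemma independent_set_signature_fibre:
  "independent_set (birkhoff_graph (2 ^ k)) (signature k -` {h} \<inter> {\<pi>. \<pi> permutes {1..2 ^ k}})"
  unfolding independent_set_def birkhoff_graph_arc_iff
proof (intro conjI ballI)
  show "signature k -` {h} \<inter> {\<pi>. \<pi> permutes {1..2 ^ k}} \<subseteq> pverts (birkhoff_graph (2 ^ k))"
    by (auto simp: birkhoff_graph_def cayley_graph_def sym_group_carrier)
  fix \<pi> \<rho>
  assume "\<pi> \<in> signature k -` {h} \<inter> {\<pi>. \<pi> permutes {1..2 ^ k}}"
    and "\<rho> \<in> signature k -` {h} \<inter> {\<pi>. \<pi> permutes {1..2 ^ k}}"
  then show "\<not> (\<rho> permutes {1..2 ^ k} \<and> \<pi> permutes {1..2 ^ k} \<and> \<rho> \<circ> inv' \<pi> \<in> cycles (2 ^ k))"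
    using not_cycle_of_signature_eq[of \<pi> k \<rho>] by simp
qed

theorem corollary1p6:
  fixes n :: nat
  assumes "\<exists>k::nat. n = 2 ^ k"
  shows "\<exists>A. independent_set (birkhoff_graph n) A \<and> real (card A) \<ge> fact n / 9 ^ n"
proof -
  obtain k where n: "n = 2 ^ k"
    using assms by blast
  let ?Perms = "{\<pi>. \<pi> permutes {1..n}}"
  let ?Rows = "SIGMA s:{..<k}. {..<2 ^ Suc s :: nat}"
  let ?Cols = "SIGMA s:{..<k}. {..<2 ^ s :: nat}"
  let ?H = "Pow ?Rows \<times> Pow ?Cols"
  have fin: "finite ?H" by simp
  have pow: "(\<Sum>s<k. 2 ^ s :: nat) = n - 1"
    by (simp add: n sum_power2 lessThan_atLeast0)
  have "card ?Cols = n - 1" "card ?Rows = 2 * (n - 1)"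
    by (simp_all add: pow sum_distrib_left [symmetric])
  \<comment> \<open>The row parities contribute \<open>4 ^ (n - 1)\<close> choices and the column
    parities \<open>2 ^ (n - 1)\<close>.\<close>
  then have card_H: "card ?H = 8 ^ (n - 1)"
    by (simp add: card_cartesian_product card_Pow power_mult power_mult_distrib [symmetric])
  have "signature k \<in> ?Perms \<rightarrow> ?H"
    by (auto simp: signature_def)
  then obtain h where "card ?Perms \<le> card (signature k -` {h} \<inter> ?Perms) * card ?H"
    using pigeonhole_card[OF _ finite_permutations fin] by blast
  then have "fact n \<le> card (signature k -` {h} \<inter> ?Perms) * 8 ^ (n - 1)"
    unfolding card_H by (simp add: card_permutations[of _ n])
  then have "real (fact n) \<le> real (card (signature k -` {h} \<inter> ?Perms) * 8 ^ (n - 1))"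
    by (rule of_nat_mono)
  then have h: "fact n \<le> real (card (signature k -` {h} \<inter> ?Perms)) * 8 ^ (n - 1)"
    unfolding of_nat_fact of_nat_mult of_nat_power of_nat_numeral .
  have "(8::real) ^ (n - 1) \<le> 9 ^ (n - 1)"
    by (intro power_mono) auto
  also have "\<dots> \<le> 9 ^ n"
    by (intro power_increasing) auto
  finally have "fact n / 9 ^ n \<le> (fact n / 8 ^ (n - 1) :: real)"
    by (intro divide_left_mono) auto
  also have "\<dots> \<le> real (card (signature k -` {h} \<inter> ?Perms))"
    using h by (simp add: field_simps)
  finally show ?thesis
    using independent_set_signature_fibre n by blast
qed

end
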